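(* Let $f_{\boldsymbol W}(\mathbf x)=\mathbf W^{L}\rho(\mathbf W^{L-1}\cdots\rho(\mathbf W^{1}\mathbf x)\cdots)$ be an $L$-layer neural network, let $N\in[L]$ with $N\neq L$, let $\epsilon_N\ge 0$, and let $f_{\widehat{\boldsymbol W}}$ be the network obtained from $f_{\boldsymbol W}$ by replacing only the $N$-th weight matrix $\mathbf W^{N}$ by some $\hat{\mathbf W}^{N}\in\mathbb B^{\infty}_{\mathbf W^{N}}(\epsilon_N)$, all other weight matrices being unchanged. Then for every input $\mathbf x$ and every pair of classes $i,j\in[K]$, $$f^{ij}_{\widehat{\boldsymbol W}}(\mathbf x)\;\le\; f^{ij}_{\boldsymbol W}(\mathbf x)+\epsilon_{N}\,\big\|W^{L}_{i,:}-W^{L}_{j,:}\big\|_{1}\,\big\|\mathbf z^{N-1}\big\|_{1}\prod_{k=1}^{L-N-1}\big\|(\mathbf W^{L-k})^{T}\big\|_{1,\infty},$$ where $\mathbf z^{k}=\rho(\mathbf W^{k}\cdots\rho(\mathbf W^{1}\mathbf x)\cdots)$ and $\mathbf z^{0}=\mathbf x$.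
   Context: $[L]=\{1,\dots,L\}$. Inputs are $\mathbf x\in\mathcal X\subseteq\mathbb R^{d}$; there are $K$ classes; the weight matrices are $\mathbf W^{h}\in\mathbb R^{d_h\times d_{h-1}}$, $h\in[L]$, with $d_0=d$, $d_L=K$, and $\boldsymbol W=(\mathbf W^1,\dots,\mathbf W^L)$. The activation $\rho:\mathbb R\to\mathbb R$ is non-negative, monotone and $1$-Lipschitz, applied element-wise to vectors; it is applied after every layer except the last. The $i$-th output is $f^{i}_{\boldsymbol W}(\mathbf x)=[f_{\boldsymbol W}(\mathbf x)]_i$, and the pairwise margin is $f^{ij}_{\boldsymbol W}(\mathbf x)=f^{i}_{\boldsymbol W}(\mathbf x)-f^{j}_{\boldsymbol W}(\mathbf x)$. $W_{i,:}$ and $W_{:,j}$ denote the $i$-th row and $j$-th column of a matrix $\mathbf W$. $\|\mathbf W\|_{1,\infty}=\max_j\|W_{:,j}\|_1$, so $\|\mathbf W^{T}\|_{1,\infty}=\max_i\|W_{i,:}\|_1$. $\mathbb B^{\infty}_{\mathbf W}(\epsilon)=\{\hat{\mathbf W}: |\hat W_{i,j}-W_{i,j}|\le\epsilon\ \forall i,j\}$. Empty products equal $1$. *)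

theory Defs
  imports "HOL-Analysis.Lipschitz" "Jordan_Normal_Form.Matrix"
begin

unbundle no vec_syntax

(* Vectors and matrices carry their dimensions at run time and are indexed from 0, so the
   classes 1, ..., K are represented by 0, ..., K - 1.  Layers keep their numbering 1, ..., L:
   the weight matrices form a family W :: nat => real mat of which only W 1, ..., W L matter. *)

definition vec_norm1 :: "real vec \<Rightarrow> real" where
  "vec_norm1 v = (\<Sum>i<dim_vec v. \<bar>v $ i\<bar>)"

(* The inserted 0 only fixes the norm of a matrix without columns; otherwise it does not
   change the maximum, the column norms being non-negative. *)
definition norm_1_inf :: "real mat \<Rightarrow> real" where
  "norm_1_inf A = Max (insert 0 ((\<lambda>j. vec_norm1 (col A j)) ` {..<dim_col A}))"

definition weight_ball :: "real mat \<Rightarrow> real \<Rightarrow> real mat set" where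
  "weight_ball A \<epsilon> = {B \<in> carrier_mat (dim_row A) (dim_col A).
     \<forall>i < dim_row A. \<forall>j < dim_col A. \<bar>B $$ (i, j) - A $$ (i, j)\<bar> \<le> \<epsilon>}"

primrec hidden :: "(real \<Rightarrow> real) \<Rightarrow> (nat \<Rightarrow> real mat) \<Rightarrow> real vec \<Rightarrow> nat \<Rightarrow> real vec" where
  "hidden \<rho> W x 0 = x"
| "hidden \<rho> W x (Suc k) = map_vec \<rho> (W (Suc k) *\<^sub>v hidden \<rho> W x k)"

(* Meant for L \<ge> 1. *)
definition network :: "(real \<Rightarrow> real) \<Rightarrow> nat \<Rightarrow> (nat \<Rightarrow> real mat) \<Rightarrow> real vec \<Rightarrow> real vec" where
  "network \<rho> L W x = W L *\<^sub>v hidden \<rho> W x (L - 1)"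

definition margin ::
  "(real \<Rightarrow> real) \<Rightarrow> nat \<Rightarrow> (nat \<Rightarrow> real mat) \<Rightarrow> nat \<Rightarrow> nat \<Rightarrow> real vec \<Rightarrow> real" where
  "margin \<rho> L W i j x = network \<rho> L W x $ i - network \<rho> L W x $ j"

end

(* An entrywise perturbation of size \<epsilon> changes every coordinate of the N-th preactivation by at most
   \<epsilon> times the 1-norm of the layer's input.  A 1-Lipschitz activation does not increase this
   bound in the sup norm, and a linear layer A increases it at most by the operator norm of A from the sup norm
   to itself, which is the largest 1-norm of a row of A.  Pairing the resulting bound with the difference
   of two rows of the last matrix gives the margin estimate. *)

theory Submission
  imports Defs
begin

lemma vec_norm1_nonneg: "0 \<le> vec_norm1 v"
  by (simp add: vec_norm1_def sum_nonneg)

lemma norm_1_inf_nonneg: "0 \<le> norm_1_inf A"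
  by (simp add: norm_1_inf_def)

lemma vec_norm1_row_le:
  assumes "i < dim_row A"
  shows "vec_norm1 (row A i) \<le> norm_1_inf (transpose_mat A)"
  using assms unfolding norm_1_inf_def by (intro Max_ge) auto

text \<open>Hoelder's inequality for the 1-norm and the sup norm. An entrywise bound
  \<open>B\<close> stands in for the sup norm, so no maximum over a possibly empty index set
  arises.\<close>

lemma abs_scalar_prod_le:
  assumes "dim_vec u = dim_vec v" and "\<And>i. i < dim_vec v \<Longrightarrow> \<bar>v $ i\<bar> \<le> B"
  shows "\<bar>u \<bullet> v\<bar> \<le> vec_norm1 u * B"
proof -
  have "\<bar>u \<bullet> v\<bar> \<le> (\<Sum>i<dim_vec v. \<bar>u $ i * v $ i\<bar>)"
    by (simp add: scalar_prod_def atLeast0LessThan)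
  also have "\<dots> \<le> (\<Sum>i<dim_vec v. \<bar>u $ i\<bar> * B)"
    using assms(2) by (intro sum_mono) (simp add: abs_mult mult_left_mono)
  also have "\<dots> = vec_norm1 u * B"
    using assms(1) by (simp add: vec_norm1_def sum_distrib_right)
  finally show ?thesis .
qed

text \<open>With \<open>k\<close> = \<open>N - 1\<close> this shows that the perturbed layer still
  receives its original input.\<close>

lemma hidden_cong:
  assumes "\<And>h. 1 \<le> h \<Longrightarrow> h \<le> k \<Longrightarrow> W h = V h"
  shows "hidden \<rho> W x k = hidden \<rho> V x k"
  using assms by (induction k) auto

text \<open>The dimension of a hidden vector is read off from the last matrix applied, so a case
  distinction replaces induction.\<close>

lemma hidden_carrier:
  assumes "x \<in> carrier_vec (d 0)"
    and "\<And>h. 1 \<le> h \<Longrightarrow> h \<le> k \<Longrightarrow> W h \<in> carrier_mat (d h) (d (h - 1))"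
  shows "hidden \<rho> W x k \<in> carrier_vec (d k)"
proof (cases k)
  case 0
  then show ?thesis using assms(1) by simp
next
  case (Suc n)
  then have "W (Suc n) \<in> carrier_mat (d (Suc n)) (d n)" using assms(2)[of k] by simp
  then show ?thesis using Suc by (auto intro!: carrier_vecI)
qed

text \<open>Two matrices and two inputs allow both uses: at layer \<open>N\<close> the matrices
  differ and the inputs agree, at later layers it is the other way round.\<close>

lemma lipschitz_hidden_layer:
  fixes \<rho> :: "real \<Rightarrow> real"
  assumes "1-lipschitz_on UNIV \<rho>" and "i < dim_row A" and "i < dim_row B"
  shows "\<bar>map_vec \<rho> (A *\<^sub>v u) $ i - map_vec \<rho> (B *\<^sub>v v) $ i\<bar> \<le> \<bar>row A i \<bullet> u - row B i \<bullet> v\<bar>"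
  using lipschitz_onD[OF assms(1), of "row A i \<bullet> u" "row B i \<bullet> v"] assms(2,3)
  by (simp add: dist_real_def)

lemma hidden_perturbation:
  fixes W :: "nat \<Rightarrow> real mat"
  assumes weights: "\<And>k. 1 \<le> k \<Longrightarrow> k \<le> h \<Longrightarrow> W k \<in> carrier_mat (d k) (d (k - 1))"
    and x: "x \<in> carrier_vec (d 0)"
    and lip: "1-lipschitz_on UNIV \<rho>"
    and N: "1 \<le> N" "N \<le> h"
    and \<epsilon>: "0 \<le> \<epsilon>"
    and A: "A \<in> weight_ball (W N) \<epsilon>"
    and i: "i < d h"
  shows "\<bar>hidden \<rho> (W(N := A)) x h $ i - hidden \<rho> W x h $ i\<bar>
    \<le> \<epsilon> * vec_norm1 (hidden \<rho> W x (N - 1)) * (\<Prod>k\<in>{N<..h}. norm_1_inf (transpose_mat (W k)))"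
  using N(2) weights i
\<comment> \<open>The induction starts at the perturbed layer, where the product is empty. The index
  \<open>i\<close> is generalised because a coordinate of one layer depends on all coordinates of
  the layer before.\<close>
proof (induction h arbitrary: i rule: dec_induct)
  case base
  obtain n where n: "N = Suc n" using N(1) by (cases N) auto
  let ?z = "hidden \<rho> W x n"
  have WN: "W N \<in> carrier_mat (d N) (d n)" using base(1)[of N] N n by simp
  have AN: "A \<in> carrier_mat (d N) (d n)" using A WN by (auto simp: weight_ball_def)
  have z: "?z \<in> carrier_vec (d n)" using base(1) n x by (intro hidden_carrier) auto
  have z': "hidden \<rho> (W(N := A)) x n = ?z" using n by (intro hidden_cong) auto
  have rows: "row A i \<in> carrier_vec (d n)" "row (W N) i \<in> carrier_vec (d n)"
    using AN WN base(2) by auto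
  have "\<bar>hidden \<rho> (W(N := A)) x N $ i - hidden \<rho> W x N $ i\<bar> \<le> \<bar>row A i \<bullet> ?z - row (W N) i \<bullet> ?z\<bar>"
    using lipschitz_hidden_layer[OF lip, of i A "W N" ?z ?z] AN WN base(2) z' n by simp
  \<comment> \<open>The factors are swapped so that \<open>?z\<close> is measured in the 1-norm and
    the row difference, with entries at most \<epsilon>, in the sup norm.\<close>
  also have "row A i \<bullet> ?z - row (W N) i \<bullet> ?z = ?z \<bullet> (row A i - row (W N) i)"
    using minus_scalar_prod_distrib[OF rows z] z rows by (simp add: comm_scalar_prod[of _ "d n"])
  also have "\<bar>\<dots>\<bar> \<le> vec_norm1 ?z * \<epsilon>"
    using z AN WN A base(2) by (intro abs_scalar_prod_le) (auto simp: weight_ball_def)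
  finally show ?case using n by (simp add: mult.commute)
next
  case (step h)
  let ?B = "\<epsilon> * vec_norm1 (hidden \<rho> W x (N - 1)) * (\<Prod>k\<in>{N<..h}. norm_1_inf (transpose_mat (W k)))"
  let ?z = "hidden \<rho> W x h" and ?z' = "hidden \<rho> (W(N := A)) x h"
  \<comment> \<open>Needed below, where the 1-norm of a row, as a factor of \<open>?B\<close>, is
    enlarged to the norm of the whole matrix.\<close>
  have B: "0 \<le> ?B"
    by (intro mult_nonneg_nonneg prod_nonneg \<epsilon> vec_norm1_nonneg norm_1_inf_nonneg)
  have Wh: "W (Suc h) \<in> carrier_mat (d (Suc h)) (d h)" using step.prems(1)[of "Suc h"] by simp
  have WN: "W N \<in> carrier_mat (d N) (d (N - 1))" using step.prems(1)[of N] step.hyps N(1) by simp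
  have AN: "A \<in> carrier_mat (d N) (d (N - 1))" using A WN by (auto simp: weight_ball_def)
  have z: "?z \<in> carrier_vec (d h)" using step.prems(1) x by (intro hidden_carrier) auto
  have z': "?z' \<in> carrier_vec (d h)"
    using step.prems(1) AN x by (intro hidden_carrier) auto
  let ?r = "row (W (Suc h)) i"
  have r: "?r \<in> carrier_vec (d h)" using Wh step.prems(2) by auto
  \<comment> \<open>Since \<open>N\<close> \<le> \<open>h\<close>, the update leaves
    \<open>W (Suc h)\<close> unchanged, and only the inputs of this layer differ.\<close>
  have "\<bar>hidden \<rho> (W(N := A)) x (Suc h) $ i - hidden \<rho> W x (Suc h) $ i\<bar> \<le> \<bar>?r \<bullet> ?z' - ?r \<bullet> ?z\<bar>"
    using lipschitz_hidden_layer[OF lip, of i "W (Suc h)" "W (Suc h)" ?z' ?z] Wh step.prems(2) step.hyps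
    by simp
  also have "?r \<bullet> ?z' - ?r \<bullet> ?z = ?r \<bullet> (?z' - ?z)"
    using scalar_prod_minus_distrib[OF r z' z] by simp
  also have "\<bar>\<dots>\<bar> \<le> vec_norm1 ?r * ?B"
  proof (rule abs_scalar_prod_le)
    show "dim_vec ?r = dim_vec (?z' - ?z)" using Wh z by auto
    fix l
    assume "l < dim_vec (?z' - ?z)"
    moreover have "\<bar>?z' $ l - ?z $ l\<bar> \<le> ?B" if "l < d h"
      using that step.prems(1) by (intro step.IH) auto
    ultimately show "\<bar>(?z' - ?z) $ l\<bar> \<le> ?B" using z z' by auto
  qed
  also have "\<dots> \<le> norm_1_inf (transpose_mat (W (Suc h))) * ?B"
    using Wh step.prems(2) by (intro mult_right_mono vec_norm1_row_le B) auto
  also have "\<dots> = \<epsilon> * vec_norm1 (hidden \<rho> W x (N - 1))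
      * (\<Prod>k\<in>{N<..Suc h}. norm_1_inf (transpose_mat (W k)))"
  proof -
    have "{N<..Suc h} = insert (Suc h) {N<..h}" using step.hyps by auto
    then show ?thesis by simp
  qed
  finally show ?case .
qed

theorem theorem1:
  fixes L N K :: nat and d :: "nat \<Rightarrow> nat"
    and W :: "nat \<Rightarrow> real mat" and W\<^sub>N' :: "real mat"
    and \<rho> :: "real \<Rightarrow> real" and \<epsilon>\<^sub>N :: real and X :: "real vec set"
  assumes weights: "\<And>h. h \<in> {1..L} \<Longrightarrow> W h \<in> carrier_mat (d h) (d (h - 1))"
    and classes: "d L = K"
    and inputs: "X \<subseteq> carrier_vec (d 0)"
    and \<rho>_nonneg: "\<And>t. 0 \<le> \<rho> t"
    and \<rho>_monotone: "mono \<rho> \<or> antimono \<rho>"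
    and \<rho>_lipschitz: "1-lipschitz_on UNIV \<rho>"
    and layer: "N \<in> {1..L}" "N \<noteq> L"
    and \<epsilon>_nonneg: "0 \<le> \<epsilon>\<^sub>N"
    and perturbed: "W\<^sub>N' \<in> weight_ball (W N) \<epsilon>\<^sub>N"
  shows "\<forall>x\<in>X. \<forall>i<K. \<forall>j<K.
    margin \<rho> L (W(N := W\<^sub>N')) i j x
      \<le> margin \<rho> L W i j x
        + \<epsilon>\<^sub>N * vec_norm1 (row (W L) i - row (W L) j) * vec_norm1 (hidden \<rho> W x (N - 1))
          * (\<Prod>k=1..L - N - 1. norm_1_inf (transpose_mat (W (L - k))))"
proof (intro ballI allI impI)
  fix x i j
  assume "x \<in> X" and i: "i < K" and j: "j < K"
  then have x: "x \<in> carrier_vec (d 0)" using inputs by auto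
  \<comment> \<open>The last hidden layer; \<open>N\<close> \<noteq> \<open>L\<close> places the
    perturbation at or before it.\<close>
  define h where "h = L - 1"
  have L: "L = Suc h" "1 \<le> N" "N \<le> h" using layer by (auto simp: h_def)
  let ?V = "W(N := W\<^sub>N')"
  let ?z = "hidden \<rho> W x h" and ?z' = "hidden \<rho> ?V x h"
  let ?B = "\<epsilon>\<^sub>N * vec_norm1 (hidden \<rho> W x (N - 1)) * (\<Prod>k\<in>{N<..h}. norm_1_inf (transpose_mat (W k)))"
  have WL: "W L \<in> carrier_mat K (d h)" using weights[of L] L classes by auto
  have "W N \<in> carrier_mat (d N) (d (N - 1))" using weights layer by simp
  then have W\<^sub>N': "W\<^sub>N' \<in> carrier_mat (d N) (d (N - 1))"
    using perturbed by (auto simp: weight_ball_def)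
  have z: "?z \<in> carrier_vec (d h)"
    using weights x L by (intro hidden_carrier) auto
  have z': "?z' \<in> carrier_vec (d h)"
    using weights x L W\<^sub>N' by (intro hidden_carrier) auto
  let ?r = "row (W L) i - row (W L) j"
  have ri: "row (W L) i \<in> carrier_vec (d h)" and rj: "row (W L) j \<in> carrier_vec (d h)"
    using WL i j by auto
  then have r: "?r \<in> carrier_vec (d h)" by auto
  \<comment> \<open>The output matrix \<open>W L\<close> is common to both networks, so both margins
    are the same linear functional of the last hidden vector.\<close>
  have margin: "margin \<rho> L W i j x = ?r \<bullet> ?z" "margin \<rho> L ?V i j x = ?r \<bullet> ?z'"
    using WL i j L minus_scalar_prod_distrib[OF ri rj z] minus_scalar_prod_distrib[OF ri rj z']
    by (auto simp: margin_def network_def)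
  have "?r \<bullet> ?z' - ?r \<bullet> ?z = ?r \<bullet> (?z' - ?z)"
    using scalar_prod_minus_distrib[OF r z' z] by simp
  also have "\<dots> \<le> \<bar>?r \<bullet> (?z' - ?z)\<bar>" by simp
  also have "\<dots> \<le> vec_norm1 ?r * ?B"
  proof (rule abs_scalar_prod_le)
    show "dim_vec ?r = dim_vec (?z' - ?z)" using WL z by auto
    fix l
    assume "l < dim_vec (?z' - ?z)"
    moreover have "\<bar>?z' $ l - ?z $ l\<bar> \<le> ?B" if "l < d h"
      using weights x \<rho>_lipschitz L \<epsilon>_nonneg perturbed that
      by (intro hidden_perturbation[where d = d]) auto
    ultimately show "\<bar>(?z' - ?z) $ l\<bar> \<le> ?B" using z z' by auto
  qed
  \<comment> \<open>The self-inverse map from \<open>k\<close> to \<open>L - k\<close> exchanges the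
    layers \<open>N + 1\<close> to \<open>L - 1\<close> with the indices 1 to
    \<open>L - N - 1\<close>; both ranges are empty if \<open>N\<close> =
    \<open>L - 1\<close>.\<close>
  also have "(\<Prod>k\<in>{N<..h}. norm_1_inf (transpose_mat (W k)))
      = (\<Prod>k=1..L - N - 1. norm_1_inf (transpose_mat (W (L - k))))"
    by (rule prod.reindex_bij_witness[of _ "\<lambda>k. L - k" "\<lambda>k. L - k"]) (use L in auto)
  finally show "margin \<rho> L ?V i j x
      \<le> margin \<rho> L W i j x
        + \<epsilon>\<^sub>N * vec_norm1 ?r * vec_norm1 (hidden \<rho> W x (N - 1))
          * (\<Prod>k=1..L - N - 1. norm_1_inf (transpose_mat (W (L - k))))"
    by (simp add: margin algebra_simps del: fun_upd_apply)
qed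

end
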